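(* Let $k$ and $r$ be fixed integers with $k>r\ge0$, let $i=\sqrt{-1}$, and let $n\ge 0$ be an integer. If $k-r$ is even, then $$\sum_{m=0}^nF_{km+r}F_{k(n-m)+r}=F_{k-r}\left(-(n+1)F_{k(n+1)+r}+\sum_{j=0}^n(-1)^{rj}\frac{F_kF_{k-r}^j}{2}\left(\frac{(-1)^j}{(F_k+F_r)^{j+1}}+\frac{1}{(F_k-F_r)^{j+1}}\right)(n-j+1)F_{k(n-j+1)+r}\right).$$ If $k-r$ is odd, then $$\sum_{m=0}^nF_{km+r}F_{k(n-m)+r}=F_{k-r}\left((n+1)F_{k(n+1)+r}-\sum_{j=0}^n(-1)^{rj}\frac{F_k(F_{k-r}i)^j}{2}\left(\frac{1}{(F_k+F_ri)^{j+1}}+\frac{(-1)^j}{(F_k-F_ri)^{j+1}}\right)(n-j+1)F_{k(n-j+1)+r}\right).$$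
   Context: $F_n$ denotes the Fibonacci numbers: $F_0=0$, $F_1=1$, $F_n=F_{n-1}+F_{n-2}$.
   Formalization: In the odd case the factor (-1)^j is moved from the term 1/(F_k-F_r i)^{j+1} to the term 1/(F_k+F_r i)^{j+1}; as printed the formula fails for k=2, r=1, n=1 (left side 4, right side 6). *)

theory Defs
  imports Complex_Main "HOL-Number_Theory.Fib"
begin

text \<open>
  The Fibonacci numbers are the library's \<open>fib :: nat \<Rightarrow> nat\<close>, with \<open>fib 0 = 0\<close> and \<open>fib 1 = 1\<close>.

  For \<open>k - r\<close> odd, the power \<open>(-1)^j\<close> belongs to the denominator \<open>fib k + fib r * \<i>\<close>, as it
  belongs to \<open>fib k + fib r\<close> for \<open>k - r\<close> even. The version found in print, with \<open>(-1)^j\<close> at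
  \<open>fib k - fib r * \<i>\<close> instead, is false: for \<open>k = 2\<close>, \<open>r = 1\<close>, \<open>n = 1\<close> its two sides are 4 and 6.
\<close>

end

theory Submission
  imports Defs "HOL-Computational_Algebra.Formal_Power_Series"
begin

text \<open>
  With \<open>N = F\<^sub>r + (-1)\<^sup>r F\<^bsub>k-r\<^esub> X\<close> and \<open>D = 1 - L\<^sub>k X + (-1)\<^sup>k X\<^sup>2\<close>, where \<open>L\<^sub>k\<close> is a Lucas
  number, the generating function of \<open>F\<^bsub>km+r\<^esub>\<close> is \<open>A = N/D\<close>. For \<open>w\<^sup>2 = (-1)\<^bsup>k-r\<^esup>\<close> Catalan's
  identity gives \<open>F\<^bsub>k-r\<^esub> D\<^sup>2 A' = F\<^sub>k\<^sup>2 - w\<^sup>2 N\<^sup>2 = (F\<^sub>k + w N) (F\<^sub>k - w N)\<close>, so that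
  \<open>A\<^sup>2 = - w\<^sup>2 F\<^bsub>k-r\<^esub> A' (1 - F\<^sub>k/2 (1/(F\<^sub>k + w N) + 1/(F\<^sub>k - w N)))\<close>. Comparing coefficients
  yields both cases, with \<open>w = 1\<close> and \<open>w = \<i>\<close> respectively.
\<close>

text \<open>Binet's formula with the roots kept abstract: since \<open>x * y = -1\<close>, every
  sign \<open>(-1) ^ n\<close> can be written \<open>x ^ n * y ^ n\<close>, and Fibonacci identities
  become polynomial identities in powers of \<open>x\<close> and \<open>y\<close>.\<close>

lemma fib_binet:
  obtains x y s :: real
  where "x * y = -1" and "s \<noteq> 0" and "\<And>n. real (fib n) = (x ^ n - y ^ n) / s"
proof
  show "((1 + sqrt 5) / 2) * ((1 - sqrt 5) / 2) = (-1 :: real)"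
    by (simp add: field_simps)
  show "sqrt 5 \<noteq> (0 :: real)" by simp
  show "real (fib n) = (((1 + sqrt 5) / 2) ^ n - ((1 - sqrt 5) / 2) ^ n) / sqrt 5" for n
    by (simp add: fib_closed_form)
qed

lemma fib_catalan:
  assumes "r \<le> k"
  shows "(real (fib k))\<^sup>2 - (-1) ^ (k - r) * (real (fib r))\<^sup>2 = real (fib (k - r)) * real (fib (k + r))"
proof -
  obtain x y s :: real where xy: "x * y = -1" and s: "s \<noteq> 0"
    and F: "\<And>n. real (fib n) = (x ^ n - y ^ n) / s"
    using fib_binet by blast
  define d where "d = k - r"
  have k: "k = r + d" using assms by (simp add: d_def)
  \<comment> \<open>Catalan's identity with \<open>(-1) ^ d\<close> replaced by
    \<open>x^d * y^d\<close>, which holds for arbitrary \<open>x\<close> and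
    \<open>y\<close>.\<close>
  have "((x^r * x^d - y^r * y^d) / s)\<^sup>2 - x^d * y^d * ((x^r - y^r) / s)\<^sup>2
      = (x^d - y^d) / s * ((x^r * x^r * x^d - y^r * y^r * y^d) / s)"
    using s by (simp add: field_simps power2_eq_square)
  then show ?thesis
    unfolding F k by (simp add: power_add power_mult_distrib[symmetric] xy mult_ac)
qed

text \<open>Here \<open>L\<close> is the Lucas number \<open>x ^ k + y ^ k\<close>. The first
  equation will give the coefficient of X in the numerator \<open>N\<close>; the second makes all
  higher coefficients of \<open>A * D\<close> vanish.\<close>

lemma fib_arith_recurrence:
  obtains L :: real
  where "\<And>r. r \<le> k \<Longrightarrow> real (fib (k + r)) = L * real (fib r) + (-1) ^ r * real (fib (k - r))"
    and "\<And>m. real (fib (m + 2 * k)) = L * real (fib (m + k)) - (-1) ^ k * real (fib m)"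
proof -
  obtain x y s :: real where xy: "x * y = -1" and s: "s \<noteq> 0"
    and F: "\<And>n. real (fib n) = (x ^ n - y ^ n) / s"
    using fib_binet by blast
  have sgn: "(-1) ^ n = x ^ n * y ^ n" for n
    by (simp add: power_mult_distrib[symmetric] xy)
  show ?thesis
  proof
    show "real (fib (k + r)) = (x ^ k + y ^ k) * real (fib r) + (-1) ^ r * real (fib (k - r))"
      if "r \<le> k" for r
    proof -
      define d where "d = k - r"
      have k: "k = r + d" using that by (simp add: d_def)
      show ?thesis
        unfolding F sgn k using s by (simp add: power_add field_simps)
    qed
    show "real (fib (m + 2 * k)) = (x ^ k + y ^ k) * real (fib (m + k)) - (-1) ^ k * real (fib m)" for m
      unfolding F sgn using s by (simp add: power_add mult_2 mult_2_right field_simps)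
  qed
qed

unbundle fps_syntax

text \<open>The geometric series for \<open>1 / (p + q X)\<close>, checked coefficientwise:
  consecutive terms cancel above degree 0.\<close>

lemma fps_reciprocal_linear:
  fixes p q :: "'a :: field"
  assumes "p \<noteq> 0"
  shows "Abs_fps (\<lambda>j. (- q) ^ j / p ^ (j + 1)) * (fps_const p + fps_const q * fps_X) = 1"
    (is "?g * _ = _")
proof (rule fps_ext)
  fix n
  have "?g * (fps_const p + fps_const q * fps_X) = fps_const p * ?g + fps_const q * (fps_X * ?g)"
    by (simp add: algebra_simps)
  then show "(?g * (fps_const p + fps_const q * fps_X)) $ n = 1 $ n"
    using assms by (cases n) (simp_all add: field_simps)
qed

text \<open>Both sides are compared after multiplication by \<open>D\<^sup>2\<close>, which can be
  cancelled because power series over a field form an integral domain. The factor 2 is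
  \<open>P + Q = 2 * c\<close> at work: \<open>P * Q * (gP + gQ)\<close> equals
  \<open>2 * c\<close>.\<close>

lemma fps_square_eq_deriv_product:
  fixes A D N P Q gP gQ a c w s :: "'a :: field_char_0 fps"
  assumes AD: "A * D = N" and D: "D \<noteq> 0"
    and P: "P = c + w * N" and Q: "Q = c - w * N"
    and gP: "gP * P = 1" and gQ: "gQ * Q = 1"
    and w: "w\<^sup>2 * w\<^sup>2 = 1"
    and key: "a * (fps_deriv N * D - N * fps_deriv D) = P * Q"
  shows "2 * A\<^sup>2 = - (w\<^sup>2) * a * ((2 - c * (gP + gQ)) * fps_deriv A)"
proof -
  have dN: "fps_deriv N = fps_deriv A * D + A * fps_deriv D"
    by (simp add: AD[symmetric])
  \<comment> \<open>The quotient rule for \<open>A = N / D\<close>, cleared of denominators.\<close>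
  have key': "a * fps_deriv A * D\<^sup>2 = P * Q"
    unfolding key[symmetric] dN AD[symmetric] by (simp add: algebra_simps power2_eq_square)
  have PQ: "P * Q = c\<^sup>2 - w\<^sup>2 * N\<^sup>2"
    by (simp add: P Q algebra_simps power2_eq_square)
  have "P * Q * (2 - c * (gP + gQ)) = 2 * (P * Q) - c * ((gP * P) * Q + (gQ * Q) * P)"
    by (simp add: algebra_simps)
  also have "\<dots> = - 2 * w\<^sup>2 * N\<^sup>2"
    unfolding gP gQ PQ by (simp add: P Q algebra_simps power2_eq_square)
  finally have G: "P * Q * (2 - c * (gP + gQ)) = - 2 * w\<^sup>2 * N\<^sup>2" .
  have "(- (w\<^sup>2) * a * ((2 - c * (gP + gQ)) * fps_deriv A)) * D\<^sup>2
      = - (w\<^sup>2) * (2 - c * (gP + gQ)) * (a * fps_deriv A * D\<^sup>2)"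
    by (simp add: mult_ac)
  also have "\<dots> = - (w\<^sup>2) * (P * Q * (2 - c * (gP + gQ)))"
    unfolding key' by (simp add: mult_ac)
  also have "\<dots> = 2 * (w\<^sup>2 * w\<^sup>2) * N\<^sup>2"
    unfolding G by (simp add: mult_ac)
  also have "\<dots> = 2 * A\<^sup>2 * D\<^sup>2"
    unfolding w by (simp add: AD[symmetric] power_mult_distrib)
  finally show ?thesis
    using D by (metis mult_right_cancel power_not_zero)
qed

text \<open>Both parities at once: \<open>w\<close> is a square root of the sign
  \<open>(-1) ^ (k - r)\<close>, and the type is left open so that \<open>w\<close> may be real or
  complex. The factor \<open>- (w\<^sup>2)\<close> carries the difference in sign between the two
  cases.\<close>

lemma fib_convolution:
  fixes k r n :: nat and w :: "'a :: real_field"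
  assumes "r < k" and w: "w\<^sup>2 = (-1) ^ (k - r)"
  shows "(\<Sum>m = 0..n. of_nat (fib (k * m + r)) * of_nat (fib (k * (n - m) + r))) =
      - (w\<^sup>2) * of_nat (fib (k - r)) *
        ((of_nat n + 1) * of_nat (fib (k * (n + 1) + r)) -
         (\<Sum>j = 0..n. (-1) ^ (r * j) *
            (of_nat (fib k) * (of_nat (fib (k - r)) * w) ^ j / 2) *
            ((-1) ^ j / (of_nat (fib k) + of_nat (fib r) * w) ^ (j + 1) +
             1 / (of_nat (fib k) - of_nat (fib r) * w) ^ (j + 1)) *
            of_nat (n - j + 1) * of_nat (fib (k * (n - j + 1) + r))))"
proof -
  obtain L0 where L1: "\<And>r. r \<le> k \<Longrightarrow> real (fib (k + r)) = L0 * real (fib r) + (-1) ^ r * real (fib (k - r))"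
    and L2: "\<And>m. real (fib (m + 2 * k)) = L0 * real (fib (m + k)) - (-1) ^ k * real (fib m)"
    using fib_arith_recurrence by blast
  define L :: 'a where "L = of_real L0"
  define a b c e :: 'a where "a = of_nat (fib (k - r))" and "b = of_nat (fib r)"
    and "c = of_nat (fib k)" and "e = (-1) ^ r"
  have ee: "e * e = 1"
    by (simp add: e_def power_mult_distrib[symmetric])
  have ww: "w\<^sup>2 * w\<^sup>2 = 1"
    unfolding w by (simp add: power_mult_distrib[symmetric])
  have sgn_k: "(-1) ^ k = e * w\<^sup>2"
    unfolding w e_def power_add[symmetric] using assms by simp
  have first: "of_nat (fib (k + r)) = L * b + e * a"
    using arg_cong[OF L1[of r], of "of_real :: real \<Rightarrow> 'a"] assms
    by (simp add: L_def a_def b_def e_def)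
  have rec: "of_nat (fib (m + 2 * k)) = L * of_nat (fib (m + k)) - e * w\<^sup>2 * of_nat (fib m)" for m
    using arg_cong[OF L2[of m], of "of_real :: real \<Rightarrow> 'a"]
    by (simp add: L_def sgn_k)
  have cat: "c\<^sup>2 - w\<^sup>2 * b\<^sup>2 = a * of_nat (fib (k + r))"
    using arg_cong[OF fib_catalan[of r k], of "of_real :: real \<Rightarrow> 'a"] assms
    by (simp add: a_def b_def c_def w)
  \<comment> \<open>By Catalan's identity this is a product of two Fibonacci numbers of positive
    index. Its factors \<open>c + b * w\<close> and \<open>c - b * w\<close> are the constant terms
    of \<open>P\<close> and \<open>Q\<close>, which must be invertible.\<close>
  have "c\<^sup>2 - w\<^sup>2 * b\<^sup>2 \<noteq> 0"
    unfolding cat a_def using assms by (simp add: fib_neq_0_nat)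
  moreover have "c\<^sup>2 - w\<^sup>2 * b\<^sup>2 = (c + b * w) * (c - b * w)"
    by (simp add: algebra_simps power2_eq_square)
  ultimately have nz: "c + b * w \<noteq> 0" "c - b * w \<noteq> 0" by auto

  define A where "A = Abs_fps (\<lambda>m. of_nat (fib (k * m + r)) :: 'a)"
  define N where "N = fps_const b + fps_const (e * a) * fps_X"
  define D where "D = 1 - fps_const L * fps_X + fps_const (e * w\<^sup>2) * fps_X * fps_X"
  define P where "P = fps_const c + fps_const w * N"
  define Q where "Q = fps_const c - fps_const w * N"
  define gP where "gP = Abs_fps (\<lambda>j. (- (e * a * w)) ^ j / (c + b * w) ^ (j + 1))"
  define gQ where "gQ = Abs_fps (\<lambda>j. (e * a * w) ^ j / (c - b * w) ^ (j + 1))"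
  have "A * D = A - fps_const L * (fps_X * A) + fps_const (e * w\<^sup>2) * (fps_X * (fps_X * A))"
    by (simp add: D_def algebra_simps)
  \<comment> \<open>Degree 0 gives \<open>b\<close>, degree 1 is \<open>first\<close>, and from
    degree 2 on the recurrence with step \<open>k\<close> gives 0.\<close>
  also have "\<dots> $ m = N $ m" for m
  proof (cases m)
    case 0
    then show ?thesis by (simp add: A_def N_def b_def)
  next
    case (Suc m')
    show ?thesis
    proof (cases m')
      case 0
      then show ?thesis using Suc first by (simp add: A_def N_def b_def)
    next
      case (Suc m'')
      then show ?thesis using \<open>m = Suc m'\<close> rec[of "k * m'' + r"]
        by (simp add: A_def N_def algebra_simps mult_2_right)
    qed
  qed
  then have AD: "A * D = N"
    using calculation by (simp add: fps_eq_iff)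
  have "D $ 0 = 1" by (simp add: D_def mult.assoc)
  then have D: "D \<noteq> 0" by auto
  have "P = fps_const (c + b * w) + fps_const (e * a * w) * fps_X"
    by (simp add: P_def N_def algebra_simps flip: fps_const_add fps_const_mult)
  then have gP: "gP * P = 1"
    unfolding gP_def using fps_reciprocal_linear[OF nz(1), of "e * a * w"] by simp
  have "Q = fps_const (c - b * w) + fps_const (- (e * a * w)) * fps_X"
    by (simp add: Q_def N_def algebra_simps flip: fps_const_add fps_const_mult fps_const_sub fps_const_neg)
  then have gQ: "gQ * Q = 1"
    unfolding gQ_def using fps_reciprocal_linear[OF nz(2), of "- (e * a * w)"] by simp
  define X' where "X' = (fps_X :: 'a fps)"
  have dD: "fps_deriv D = - fps_const L + 2 * fps_const (e * w\<^sup>2) * X'"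
    by (simp add: D_def X'_def algebra_simps)
  have dN: "fps_deriv N = fps_const e * fps_const a"
    by (simp add: N_def)
  have key: "fps_const a * (fps_deriv N * D - N * fps_deriv D) = P * Q"
  proof -
    \<comment> \<open>As polynomials in X, the two sides of \<open>key\<close> have constant terms
      that agree by Catalan's identity with \<open>first\<close> inserted, and quadratic terms that
      agree by \<open>e * e = 1\<close>; the linear terms are identical.\<close>
    have 1: "(fps_const c)\<^sup>2 - (fps_const w)\<^sup>2 * (fps_const b)\<^sup>2
        = fps_const a * (fps_const L * fps_const b + fps_const e * fps_const a)"
      using arg_cong[OF cat[unfolded first], of fps_const]
      by (simp add: fps_const_power)
    have 2: "fps_const e * fps_const e = 1" by (simp add: ee)
    show ?thesis
      unfolding dD dN unfolding P_def Q_def N_def D_def X'_def[symmetric]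
      using 1 2 unfolding fps_const_mult[symmetric] fps_const_power[symmetric]
      by algebra
  qed
  have "2 * A\<^sup>2 = - ((fps_const w)\<^sup>2) * fps_const a * ((2 - fps_const c * (gP + gQ)) * fps_deriv A)"
    by (rule fps_square_eq_deriv_product[OF AD D P_def Q_def gP gQ _ key])
       (simp only: fps_const_power fps_const_mult ww fps_const_1_eq_1)
  then have "fps_const 2 * (A * A)
      = fps_const (- (w\<^sup>2) * a) * (fps_const 2 * fps_deriv A - fps_const c * ((gP + gQ) * fps_deriv A))"
    by (simp add: fps_const_power power2_eq_square algebra_simps
      flip: numeral_fps_const fps_const_neg)
  then have "(fps_const 2 * (A * A)) $ n
      = (fps_const (- (w\<^sup>2) * a) * (fps_const 2 * fps_deriv A - fps_const c * ((gP + gQ) * fps_deriv A))) $ n"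
    by simp
  then have "2 * (A * A) $ n
      = - (w\<^sup>2) * a * (2 * fps_deriv A $ n - c * ((gP + gQ) * fps_deriv A) $ n)"
    by simp
  then have "(A * A) $ n
      = - (w\<^sup>2) * a * (fps_deriv A $ n - c / 2 * ((gP + gQ) * fps_deriv A) $ n)"
    by (simp add: field_simps)
  moreover have "(A * A) $ n = (\<Sum>m = 0..n. of_nat (fib (k * m + r)) * of_nat (fib (k * (n - m) + r)))"
    by (simp add: fps_mult_nth A_def)
  \<comment> \<open>Differentiation shifts the index by one; hence the weights \<open>n + 1\<close>
    here and \<open>n - j + 1\<close> in the sum below.\<close>
  moreover have "fps_deriv A $ n = (of_nat n + 1) * of_nat (fib (k * (n + 1) + r))"
    by (simp add: A_def)
  moreover have "c / 2 * ((gP + gQ) * fps_deriv A) $ n = (\<Sum>j = 0..n. (-1) ^ (r * j) *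
            (c * (a * w) ^ j / 2) *
            ((-1) ^ j / (c + b * w) ^ (j + 1) +
             1 / (c - b * w) ^ (j + 1)) *
            of_nat (n - j + 1) * of_nat (fib (k * (n - j + 1) + r)))"
    unfolding fps_mult_nth sum_distrib_left
  proof (rule sum.cong[OF refl])
    fix j
    \<comment> \<open>The power \<open>e ^ j\<close> becomes \<open>(-1) ^ (r * j)\<close>. Only the
      reciprocal of \<open>P\<close> alternates in sign, so \<open>(-1) ^ j\<close> goes with
      \<open>c + b * w\<close>.\<close>
    have "(gP + gQ) $ j = e ^ j * (a * w) ^ j * ((-1) ^ j / (c + b * w) ^ (j + 1) + 1 / (c - b * w) ^ (j + 1))"
      unfolding gP_def gQ_def power_minus[of "e * a * w"]
      by (simp add: power_mult_distrib algebra_simps)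
    moreover have "fps_deriv A $ (n - j) = of_nat (n - j + 1) * of_nat (fib (k * (n - j + 1) + r))"
      by (simp add: A_def)
    ultimately show "c / 2 * ((gP + gQ) $ j * fps_deriv A $ (n - j)) = (-1) ^ (r * j) *
            (c * (a * w) ^ j / 2) *
            ((-1) ^ j / (c + b * w) ^ (j + 1) +
             1 / (c - b * w) ^ (j + 1)) *
            of_nat (n - j + 1) * of_nat (fib (k * (n - j + 1) + r))"
      by (simp only: e_def power_mult) (simp only: mult_ac times_divide_eq_right times_divide_eq_left)
  qed
  ultimately show ?thesis
    unfolding a_def b_def c_def by simp
qed

theorem theorem2:
  fixes k r n :: nat
  assumes "r < k"
  shows "(even (k - r) \<longrightarrow>
      (\<Sum>m = 0..n. real (fib (k * m + r)) * real (fib (k * (n - m) + r))) =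
      real (fib (k - r)) *
        (- (real n + 1) * real (fib (k * (n + 1) + r)) +
         (\<Sum>j = 0..n. (-1) ^ (r * j) *
            (real (fib k) * real (fib (k - r)) ^ j / 2) *
            ((-1) ^ j / (real (fib k) + real (fib r)) ^ (j + 1) +
             1 / (real (fib k) - real (fib r)) ^ (j + 1)) *
            real (n - j + 1) * real (fib (k * (n - j + 1) + r))))) \<and>
    (odd (k - r) \<longrightarrow>
      (\<Sum>m = 0..n. (of_nat (fib (k * m + r)) :: complex) * of_nat (fib (k * (n - m) + r))) =
      of_nat (fib (k - r)) *
        ((of_nat n + 1) * of_nat (fib (k * (n + 1) + r)) -
         (\<Sum>j = 0..n. (-1) ^ (r * j) *
            (of_nat (fib k) * (of_nat (fib (k - r)) * \<i>) ^ j / 2) *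
            ((-1) ^ j / (of_nat (fib k) + of_nat (fib r) * \<i>) ^ (j + 1) +
             1 / (of_nat (fib k) - of_nat (fib r) * \<i>) ^ (j + 1)) *
            of_nat (n - j + 1) * of_nat (fib (k * (n - j + 1) + r)))))"
proof (intro conjI impI)
  assume "even (k - r)"
  then have one: "(1 :: real)\<^sup>2 = (-1) ^ (k - r)" by simp
  \<comment> \<open>For \<open>w = 1\<close> the leading factor is -1; it is moved into the bracket
    to match the stated form.\<close>
  have sgn: "- 1 * f * (g * h - S) = f * (- g * h + S)" for f g h S :: real
    by algebra
  show "(\<Sum>m = 0..n. real (fib (k * m + r)) * real (fib (k * (n - m) + r))) =
      real (fib (k - r)) *
        (- (real n + 1) * real (fib (k * (n + 1) + r)) +
         (\<Sum>j = 0..n. (-1) ^ (r * j) *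
            (real (fib k) * real (fib (k - r)) ^ j / 2) *
            ((-1) ^ j / (real (fib k) + real (fib r)) ^ (j + 1) +
             1 / (real (fib k) - real (fib r)) ^ (j + 1)) *
            real (n - j + 1) * real (fib (k * (n - j + 1) + r))))"
    using fib_convolution[OF assms one, of n] by (simp only: mult_1_right power_one sgn)
next
  assume "odd (k - r)"
  then have "\<i>\<^sup>2 = (-1) ^ (k - r)" by simp
  \<comment> \<open>For \<open>w = \<i>\<close> the leading factor \<open>- (w\<^sup>2)\<close> is
    1.\<close>
  from fib_convolution[OF assms this, of n]
  show "(\<Sum>m = 0..n. (of_nat (fib (k * m + r)) :: complex) * of_nat (fib (k * (n - m) + r))) =
      of_nat (fib (k - r)) *
        ((of_nat n + 1) * of_nat (fib (k * (n + 1) + r)) -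
         (\<Sum>j = 0..n. (-1) ^ (r * j) *
            (of_nat (fib k) * (of_nat (fib (k - r)) * \<i>) ^ j / 2) *
            ((-1) ^ j / (of_nat (fib k) + of_nat (fib r) * \<i>) ^ (j + 1) +
             1 / (of_nat (fib k) - of_nat (fib r) * \<i>) ^ (j + 1)) *
            of_nat (n - j + 1) * of_nat (fib (k * (n - j + 1) + r))))"
    by (simp only: power2_i minus_minus mult_1_left)
qed

end
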